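(* Let $\mathbf{SupOMLatLin}$ and $\mathbf{OMSupGal}$ be the dagger categories described in the context. Define $\Lambda\colon\mathbf{SupOMLatLin}\to\mathbf{OMSupGal}$ and $\Gamma\colon\mathbf{OMSupGal}\to\mathbf{SupOMLatLin}$ to be the identity on objects and, on morphisms, $\Lambda(f)=(f_{\bullet},f^{\bullet})=(\perp\circ f,\ \perp\circ f^{*})$ and $\Gamma(f_{\bullet},f^{\bullet})=\perp\circ f_{\bullet}$, where $\perp$ denotes the orthocomplement map. Then $\Lambda$ and $\Gamma$ are well defined, and they exhibit $\mathbf{SupOMLatLin}$ and $\mathbf{OMSupGal}$ as dagger isomorphic: $\Lambda$ is full, faithful and (being the identity on objects) essentially surjective, $\Lambda\circ\Gamma$ is the identity on morphisms, and $\Lambda(f^{*})=\Lambda(f)^{*}$ for every morphism $f$.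
   Context: An orthomodular lattice is a lattice $X$ with $0,1$ and an orthocomplement $x\mapsto x^{\perp}$ (involutive, order-reversing, $x\wedge x^{\perp}=0$) satisfying: $x\le y$ implies $y=x\vee(x^{\perp}\wedge y)$; complete means all joins exist. Write $x\perp y$ iff $x\le y^{\perp}$. $\mathbf{SupOMLatLin}$: objects are complete orthomodular lattices; morphisms $f\colon X\to Y$ are functions admitting a function $f^{*}\colon Y\to X$ (necessarily unique, the adjoint) with $f(x)\perp y$ iff $x\perp f^{*}(y)$ for all $x\in X,y\in Y$; composition is composition of functions; dagger is $f\mapsto f^{*}$. $\mathbf{OMSupGal}$: objects are complete orthomodular lattices; a morphism $X\to Y$ is a pair $(f_{\bullet},f^{\bullet})$ of functions $f_{\bullet}\colon X\to Y$, $f^{\bullet}\colon Y\to X$ with $x\le f^{\bullet}(y)$ iff $y\le f_{\bullet}(x)$ for all $x\in X$, $y\in Y$; the identity on $X$ is $(\perp,\perp)$; composition is $(g\circ f)_{\bullet}=g_{\bullet}\circ\perp\circ f_{\bullet}$, $(g\circ f)^{\bullet}=f^{\bullet}\circ\perp\circ g^{\bullet}$; the dagger is $(f_{\bullet},f^{\bullet})^{*}=(f^{\bullet},f_{\bullet})$. Two dagger categories are dagger isomorphic if there is a functor between them that is full, faithful, essentially surjective and preserves the dagger. *)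

theory Defs
  imports "HOL-Algebra.Complete_Lattice" "HOL-Library.FuncSet"
begin

section \<open>Dagger categories\<close>

text \<open>
  Arrows are not tagged with their end points: the same value of type \<open>'m\<close> may lie in
  several hom-sets.  Composition and dagger therefore take the objects as arguments;
  \<open>Comp C X Y Z g f\<close> is the composite of \<open>f \<in> Hom C X Y\<close> followed by \<open>g \<in> Hom C Y Z\<close>.
\<close>

record ('o, 'm) category =
  Ob :: "'o set"
  Hom :: "'o \<Rightarrow> 'o \<Rightarrow> 'm set"
  Id :: "'o \<Rightarrow> 'm"
  Comp :: "'o \<Rightarrow> 'o \<Rightarrow> 'o \<Rightarrow> 'm \<Rightarrow> 'm \<Rightarrow> 'm"

record ('o, 'm) dagger_category = "('o, 'm) category" +
  Dag :: "'o \<Rightarrow> 'o \<Rightarrow> 'm \<Rightarrow> 'm"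

locale category =
  fixes C :: "('o, 'm, 'x) category_scheme"
  assumes Id_in_Hom: "X \<in> Ob C \<Longrightarrow> Id C X \<in> Hom C X X"
    and Comp_in_Hom:
      "\<lbrakk>X \<in> Ob C; Y \<in> Ob C; Z \<in> Ob C; f \<in> Hom C X Y; g \<in> Hom C Y Z\<rbrakk>
        \<Longrightarrow> Comp C X Y Z g f \<in> Hom C X Z"
    and Comp_Id_left:
      "\<lbrakk>X \<in> Ob C; Y \<in> Ob C; f \<in> Hom C X Y\<rbrakk> \<Longrightarrow> Comp C X Y Y (Id C Y) f = f"
    and Comp_Id_right:
      "\<lbrakk>X \<in> Ob C; Y \<in> Ob C; f \<in> Hom C X Y\<rbrakk> \<Longrightarrow> Comp C X X Y f (Id C X) = f"
    and Comp_assoc: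
      "\<lbrakk>W \<in> Ob C; X \<in> Ob C; Y \<in> Ob C; Z \<in> Ob C;
        f \<in> Hom C W X; g \<in> Hom C X Y; h \<in> Hom C Y Z\<rbrakk>
        \<Longrightarrow> Comp C W Y Z h (Comp C W X Y g f) = Comp C W X Z (Comp C X Y Z h g) f"

locale dagger_category = category C for C :: "('o, 'm, 'x) dagger_category_scheme" +
  assumes Dag_in_Hom:
      "\<lbrakk>X \<in> Ob C; Y \<in> Ob C; f \<in> Hom C X Y\<rbrakk> \<Longrightarrow> Dag C X Y f \<in> Hom C Y X"
    and Dag_Dag:
      "\<lbrakk>X \<in> Ob C; Y \<in> Ob C; f \<in> Hom C X Y\<rbrakk> \<Longrightarrow> Dag C Y X (Dag C X Y f) = f"
    and Dag_Id: "X \<in> Ob C \<Longrightarrow> Dag C X X (Id C X) = Id C X"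
    and Dag_Comp:
      "\<lbrakk>X \<in> Ob C; Y \<in> Ob C; Z \<in> Ob C; f \<in> Hom C X Y; g \<in> Hom C Y Z\<rbrakk>
        \<Longrightarrow> Dag C X Z (Comp C X Y Z g f) = Comp C Z Y X (Dag C X Y f) (Dag C Y Z g)"

definition isomorphic_objects :: "('o, 'm, 'x) category_scheme \<Rightarrow> 'o \<Rightarrow> 'o \<Rightarrow> bool" where
  "isomorphic_objects C X Y \<longleftrightarrow>
    (\<exists>f \<in> Hom C X Y. \<exists>g \<in> Hom C Y X.
      Comp C X Y X g f = Id C X \<and> Comp C Y X Y f g = Id C Y)"

text \<open>A functor is given by an object map \<open>FO\<close> and, for each pair of objects, a map \<open>FM X Y\<close>
  on \<open>Hom C X Y\<close>.\<close>

locale category_functor = C: category C + D: category D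
  for C :: "('o, 'm, 'x) category_scheme" and D :: "('p, 'n, 'y) category_scheme" +
  fixes FO :: "'o \<Rightarrow> 'p" and FM :: "'o \<Rightarrow> 'o \<Rightarrow> 'm \<Rightarrow> 'n"
  assumes FO_in_Ob: "X \<in> Ob C \<Longrightarrow> FO X \<in> Ob D"
    and FM_in_Hom:
      "\<lbrakk>X \<in> Ob C; Y \<in> Ob C; f \<in> Hom C X Y\<rbrakk> \<Longrightarrow> FM X Y f \<in> Hom D (FO X) (FO Y)"
    and FM_Id: "X \<in> Ob C \<Longrightarrow> FM X X (Id C X) = Id D (FO X)"
    and FM_Comp:
      "\<lbrakk>X \<in> Ob C; Y \<in> Ob C; Z \<in> Ob C; f \<in> Hom C X Y; g \<in> Hom C Y Z\<rbrakk>
        \<Longrightarrow> FM X Z (Comp C X Y Z g f) = Comp D (FO X) (FO Y) (FO Z) (FM Y Z g) (FM X Y f)"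

definition full ::
  "('o, 'm, 'x) category_scheme \<Rightarrow> ('p, 'n, 'y) category_scheme \<Rightarrow>
   ('o \<Rightarrow> 'p) \<Rightarrow> ('o \<Rightarrow> 'o \<Rightarrow> 'm \<Rightarrow> 'n) \<Rightarrow> bool" where
  "full C D FO FM \<longleftrightarrow>
    (\<forall>X \<in> Ob C. \<forall>Y \<in> Ob C. \<forall>g \<in> Hom D (FO X) (FO Y). \<exists>f \<in> Hom C X Y. FM X Y f = g)"

definition faithful ::
  "('o, 'm, 'x) category_scheme \<Rightarrow> ('o \<Rightarrow> 'o \<Rightarrow> 'm \<Rightarrow> 'n) \<Rightarrow> bool" where
  "faithful C FM \<longleftrightarrow> (\<forall>X \<in> Ob C. \<forall>Y \<in> Ob C. inj_on (FM X Y) (Hom C X Y))"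

definition essentially_surjective ::
  "('o, 'm, 'x) category_scheme \<Rightarrow> ('p, 'n, 'y) category_scheme \<Rightarrow> ('o \<Rightarrow> 'p) \<Rightarrow> bool" where
  "essentially_surjective C D FO \<longleftrightarrow>
    (\<forall>Y \<in> Ob D. \<exists>X \<in> Ob C. isomorphic_objects D (FO X) Y)"

definition preserves_dagger ::
  "('o, 'm, 'x) dagger_category_scheme \<Rightarrow> ('p, 'n, 'y) dagger_category_scheme \<Rightarrow>
   ('o \<Rightarrow> 'p) \<Rightarrow> ('o \<Rightarrow> 'o \<Rightarrow> 'm \<Rightarrow> 'n) \<Rightarrow> bool" where
  "preserves_dagger C D FO FM \<longleftrightarrow>
    (\<forall>X \<in> Ob C. \<forall>Y \<in> Ob C. \<forall>f \<in> Hom C X Y.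
      FM Y X (Dag C X Y f) = Dag D (FO X) (FO Y) (FM X Y f))"

definition dagger_isomorphic ::
  "('o, 'm, 'x) dagger_category_scheme \<Rightarrow> ('p, 'n, 'y) dagger_category_scheme \<Rightarrow> bool" where
  "dagger_isomorphic C D \<longleftrightarrow> dagger_category C \<and> dagger_category D \<and>
    (\<exists>FO FM. category_functor C D FO FM \<and> full C D FO FM \<and> faithful C FM \<and>
      essentially_surjective C D FO \<and> preserves_dagger C D FO FM)"


section \<open>Complete orthomodular lattices\<close>

record 'a ortholattice = "'a gorder" +
  ocomp :: "'a \<Rightarrow> 'a"

locale orthomodular_lattice = bounded_lattice L
  for L :: "('a, 'x) ortholattice_scheme" (structure) +
  assumes ocomp_closed: "x \<in> carrier L \<Longrightarrow> ocomp L x \<in> carrier L"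
    and ocomp_ocomp: "x \<in> carrier L \<Longrightarrow> ocomp L (ocomp L x) = x"
    and ocomp_antitone:
      "\<lbrakk>x \<in> carrier L; y \<in> carrier L; x \<sqsubseteq> y\<rbrakk> \<Longrightarrow> ocomp L y \<sqsubseteq> ocomp L x"
    and meet_ocomp: "x \<in> carrier L \<Longrightarrow> x \<sqinter> ocomp L x = \<bottom>"
    and orthomodular:
      "\<lbrakk>x \<in> carrier L; y \<in> carrier L; x \<sqsubseteq> y\<rbrakk> \<Longrightarrow> y = x \<squnion> (ocomp L x \<sqinter> y)"

locale complete_orthomodular_lattice = orthomodular_lattice L + complete_lattice L
  for L :: "('a, 'x) ortholattice_scheme" (structure)

definition orthogonal :: "('a, 'x) ortholattice_scheme \<Rightarrow> 'a \<Rightarrow> 'a \<Rightarrow> bool" where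
  "orthogonal L x y \<longleftrightarrow> x \<sqsubseteq>\<^bsub>L\<^esub> ocomp L y"


section \<open>The two categories\<close>

text \<open>
  Objects are the complete orthomodular lattices whose carrier is a subset of an arbitrary type
  \<open>'a\<close>.  Functions between carriers are represented extensionally (\<open>\<rightarrow>\<^sub>E\<close>: the value is
  \<open>undefined\<close> outside the domain), so that equality of functions is HOL equality;
  \<open>compose (carrier X) g f\<close> is the composite \<open>g \<circ> f\<close> restricted to \<open>carrier X\<close>.  The values of order and orthocomplement outside the carrier are
  not normalised, so one lattice may be represented by several isomorphic objects.
\<close>

definition is_adjoint ::
  "'a ortholattice \<Rightarrow> 'a ortholattice \<Rightarrow> ('a \<Rightarrow> 'a) \<Rightarrow> ('a \<Rightarrow> 'a) \<Rightarrow> bool" where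
  "is_adjoint X Y f h \<longleftrightarrow> h \<in> carrier Y \<rightarrow>\<^sub>E carrier X \<and>
    (\<forall>x \<in> carrier X. \<forall>y \<in> carrier Y. orthogonal Y (f x) y \<longleftrightarrow> orthogonal X x (h y))"

definition adjoint ::
  "'a ortholattice \<Rightarrow> 'a ortholattice \<Rightarrow> ('a \<Rightarrow> 'a) \<Rightarrow> ('a \<Rightarrow> 'a)" where
  "adjoint X Y f = (THE h. is_adjoint X Y f h)"

lemma adjoint_eqI:
  assumes X: "complete_orthomodular_lattice X" and h: "is_adjoint X Y f h"
  shows "adjoint X Y f = h"
  unfolding adjoint_def
proof (rule the_equality)
  interpret X: complete_orthomodular_lattice X by (fact X)
  fix k
  assume k: "is_adjoint X Y f k"
  show "k = h"
  proof (rule PiE_ext)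
    show "k \<in> carrier Y \<rightarrow>\<^sub>E carrier X" and "h \<in> carrier Y \<rightarrow>\<^sub>E carrier X"
      using h k by (auto simp: is_adjoint_def)
    fix y
    assume y: "y \<in> carrier Y"
    have hk: "h y \<in> carrier X" "k y \<in> carrier X"
      using h k y by (auto simp: is_adjoint_def)
    have "x \<sqsubseteq>\<^bsub>X\<^esub> ocomp X (h y) \<longleftrightarrow> x \<sqsubseteq>\<^bsub>X\<^esub> ocomp X (k y)" if "x \<in> carrier X" for x
      using h k y that by (simp add: is_adjoint_def orthogonal_def)
    then have "ocomp X (h y) = ocomp X (k y)"
      using hk by (meson X.le_antisym X.le_refl X.ocomp_closed)
    then show "k y = h y"
      using hk by (metis X.ocomp_ocomp)
  qed
qed (fact h)

definition SupOMLatLin :: "('a ortholattice, 'a \<Rightarrow> 'a) dagger_category" where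
  "SupOMLatLin = \<lparr>
    Ob = {X. complete_orthomodular_lattice X},
    Hom = (\<lambda>X Y. {f \<in> carrier X \<rightarrow>\<^sub>E carrier Y. \<exists>h. is_adjoint X Y f h}),
    Id = (\<lambda>X. \<lambda>x \<in> carrier X. x),
    Comp = (\<lambda>X Y Z g f. compose (carrier X) g f),
    Dag = adjoint \<rparr>"

text \<open>A pair \<open>(l, u)\<close> in \<open>Hom OMSupGal X Y\<close> consists of the lower-dot component \<open>l\<close> from \<open>X\<close>
  to \<open>Y\<close> and the upper-dot component \<open>u\<close> from \<open>Y\<close> to \<open>X\<close>.\<close>

definition OMSupGal :: "('a ortholattice, ('a \<Rightarrow> 'a) \<times> ('a \<Rightarrow> 'a)) dagger_category" where
  "OMSupGal = \<lparr>
    Ob = {X. complete_orthomodular_lattice X},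
    Hom = (\<lambda>X Y. {(l, u). l \<in> carrier X \<rightarrow>\<^sub>E carrier Y \<and> u \<in> carrier Y \<rightarrow>\<^sub>E carrier X \<and>
      (\<forall>x \<in> carrier X. \<forall>y \<in> carrier Y. x \<sqsubseteq>\<^bsub>X\<^esub> u y \<longleftrightarrow> y \<sqsubseteq>\<^bsub>Y\<^esub> l x)}),
    Id = (\<lambda>X. (restrict (ocomp X) (carrier X), restrict (ocomp X) (carrier X))),
    Comp = (\<lambda>X Y Z g f.
      (compose (carrier X) (fst g) (compose (carrier X) (ocomp Y) (fst f)),
       compose (carrier Z) (snd f) (compose (carrier Z) (ocomp Y) (snd g)))),
    Dag = (\<lambda>X Y f. (snd f, fst f)) \<rparr>"

definition Lambda ::
  "'a ortholattice \<Rightarrow> 'a ortholattice \<Rightarrow> ('a \<Rightarrow> 'a) \<Rightarrow> ('a \<Rightarrow> 'a) \<times> ('a \<Rightarrow> 'a)" where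
  "Lambda X Y f =
    (compose (carrier X) (ocomp Y) f, compose (carrier Y) (ocomp X) (adjoint X Y f))"

definition Gamma ::
  "'a ortholattice \<Rightarrow> 'a ortholattice \<Rightarrow> ('a \<Rightarrow> 'a) \<times> ('a \<Rightarrow> 'a) \<Rightarrow> ('a \<Rightarrow> 'a)" where
  "Gamma X Y f = compose (carrier X) (ocomp Y) (fst f)"

end

theory Submission
  imports Defs
begin

text \<open>
  Both categories describe adjoint pairs.  Since \<open>x \<bottom> y\<close> means \<open>x \<le> y\<^sup>\<bottom>\<close>, the condition
  \<open>f x \<bottom> y \<longleftrightarrow> x \<bottom> h y\<close> reads \<open>y \<le> (f x)\<^sup>\<bottom> \<longleftrightarrow> x \<le> (h y)\<^sup>\<bottom>\<close>; hence \<open>h\<close> is adjoint to \<open>f\<close>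
  exactly when post-composing both with the orthocomplement gives an antitone Galois connection.
  As the orthocomplement is an involution, this correspondence is bijective, and it turns ordinary
  composition into the composition of \<open>OMSupGal\<close>.
\<close>

section \<open>Orthocomplement and orthogonality\<close>

context orthomodular_lattice
begin

text \<open>Apply antitonicity and cancel the double complement. Thus \<open>ocomp L\<close> forms
  an antitone Galois connection with itself, which is why it can serve as the identity arrow of
  \<open>OMSupGal\<close>.\<close>

lemma le_ocomp_iff:
  assumes "x \<in> carrier L" "y \<in> carrier L"
  shows "x \<sqsubseteq> ocomp L y \<longleftrightarrow> y \<sqsubseteq> ocomp L x"
  using assms by (metis ocomp_antitone ocomp_closed ocomp_ocomp)

lemma ocomp_le_iff:
  assumes "x \<in> carrier L" "y \<in> carrier L"
  shows "ocomp L x \<sqsubseteq> y \<longleftrightarrow> ocomp L y \<sqsubseteq> x"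
  using assms by (metis ocomp_antitone ocomp_closed ocomp_ocomp)

lemma orthogonal_commute:
  assumes "x \<in> carrier L" "y \<in> carrier L"
  shows "orthogonal L x y \<longleftrightarrow> orthogonal L y x"
  using assms by (simp add: orthogonal_def le_ocomp_iff)

end

section \<open>Adjoint pairs\<close>

text \<open>Orthogonality is symmetric in both lattices, so the defining equivalence can be read
  backwards. This makes the dagger of \<open>SupOMLatLin\<close> closed and involutive.
  \<open>is_adjoint\<close> puts only its last argument into a function set, hence the separate
  premise on \<open>f\<close>.\<close>

lemma is_adjoint_sym:
  assumes "orthomodular_lattice X" "orthomodular_lattice Y"
    and f: "f \<in> carrier X \<rightarrow>\<^sub>E carrier Y" and h: "is_adjoint X Y f h"
  shows "is_adjoint Y X h f"
proof -
  interpret X: orthomodular_lattice X by fact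
  interpret Y: orthomodular_lattice Y by fact
  have "orthogonal X (h y) x \<longleftrightarrow> orthogonal Y y (f x)" if "x \<in> carrier X" "y \<in> carrier Y" for x y
  proof -
    have "h y \<in> carrier X" "f x \<in> carrier Y"
      using f h that by (auto simp: is_adjoint_def)
    then show ?thesis
      using h that by (metis X.orthogonal_commute Y.orthogonal_commute is_adjoint_def)
  qed
  then show ?thesis
    using f by (auto simp: is_adjoint_def)
qed

lemma is_adjoint_id: "is_adjoint X X (\<lambda>x \<in> carrier X. x) (\<lambda>x \<in> carrier X. x)"
  by (simp add: is_adjoint_def)

lemma compose_PiE:
  assumes "f \<in> A \<rightarrow>\<^sub>E B" "g \<in> B \<rightarrow>\<^sub>E C"
  shows "compose A g f \<in> A \<rightarrow>\<^sub>E C"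
  using assms by (auto simp: compose_def)

text \<open>The maps cross over one at a time: compare \<open>g (f x)\<close> with \<open>z\<close>,
  then \<open>f x\<close> with \<open>k z\<close>, then \<open>x\<close> with
  \<open>h (k z)\<close>. The reversed order is the contravariance of the dagger.\<close>

lemma is_adjoint_compose:
  assumes "f \<in> carrier X \<rightarrow>\<^sub>E carrier Y"
    and "is_adjoint X Y f h" "is_adjoint Y Z g k"
  shows "is_adjoint X Z (compose (carrier X) g f) (compose (carrier Z) h k)"
proof -
  have h: "h \<in> carrier Y \<rightarrow>\<^sub>E carrier X" and k: "k \<in> carrier Z \<rightarrow>\<^sub>E carrier Y"
    using assms by (auto simp: is_adjoint_def)
  have "orthogonal Z (g (f x)) z \<longleftrightarrow> orthogonal X x (h (k z))"
    if "x \<in> carrier X" "z \<in> carrier Z" for x z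
  proof -
    have "f x \<in> carrier Y" "k z \<in> carrier Y"
      using assms(1) k that by auto
    then show ?thesis
      using assms(2,3) that by (simp add: is_adjoint_def)
  qed
  then show ?thesis
    using compose_PiE[OF k h] by (simp add: is_adjoint_def compose_eq)
qed

section \<open>Objects and hom-sets\<close>

lemma Ob_SupOMLatLin: "X \<in> Ob SupOMLatLin \<longleftrightarrow> complete_orthomodular_lattice X"
  by (simp add: SupOMLatLin_def)

lemma Ob_OMSupGal: "X \<in> Ob OMSupGal \<longleftrightarrow> complete_orthomodular_lattice X"
  by (simp add: OMSupGal_def)

lemma Hom_SupOMLatLinI:
  assumes "f \<in> carrier X \<rightarrow>\<^sub>E carrier Y" "is_adjoint X Y f h"
  shows "f \<in> Hom SupOMLatLin X Y"
  using assms by (auto simp: SupOMLatLin_def)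

text \<open>Uniqueness of adjoints lets the witness from the hom-set replace the definite
  description in \<open>adjoint\<close>.\<close>

lemma Hom_SupOMLatLinE:
  assumes "f \<in> Hom SupOMLatLin X Y" and "complete_orthomodular_lattice X"
  obtains h where "f \<in> carrier X \<rightarrow>\<^sub>E carrier Y" "h \<in> carrier Y \<rightarrow>\<^sub>E carrier X"
    "is_adjoint X Y f h" "adjoint X Y f = h"
proof -
  obtain h where "f \<in> carrier X \<rightarrow>\<^sub>E carrier Y" "is_adjoint X Y f h"
    using assms(1) by (auto simp: SupOMLatLin_def)
  then show ?thesis
    using that adjoint_eqI[OF assms(2)] unfolding is_adjoint_def by blast
qed

lemma Hom_OMSupGal_iff:
  "(l, u) \<in> Hom OMSupGal X Y \<longleftrightarrow>
    l \<in> carrier X \<rightarrow>\<^sub>E carrier Y \<and> u \<in> carrier Y \<rightarrow>\<^sub>E carrier X \<and>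
    (\<forall>x \<in> carrier X. \<forall>y \<in> carrier Y. x \<sqsubseteq>\<^bsub>X\<^esub> u y \<longleftrightarrow> y \<sqsubseteq>\<^bsub>Y\<^esub> l x)"
  by (simp add: OMSupGal_def)

lemma Hom_OMSupGalE:
  assumes "f \<in> Hom OMSupGal X Y"
  obtains l u where "f = (l, u)"
    "l \<in> carrier X \<rightarrow>\<^sub>E carrier Y" "u \<in> carrier Y \<rightarrow>\<^sub>E carrier X"
    "\<And>x. x \<in> carrier X \<Longrightarrow> l x \<in> carrier Y" "\<And>x. x \<notin> carrier X \<Longrightarrow> l x = undefined"
    "\<And>y. y \<in> carrier Y \<Longrightarrow> u y \<in> carrier X" "\<And>y. y \<notin> carrier Y \<Longrightarrow> u y = undefined"
    "\<And>x y. x \<in> carrier X \<Longrightarrow> y \<in> carrier Y \<Longrightarrow> x \<sqsubseteq>\<^bsub>X\<^esub> u y \<longleftrightarrow> y \<sqsubseteq>\<^bsub>Y\<^esub> l x"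
proof (cases f)
  case (Pair l u)
  then have lu: "l \<in> carrier X \<rightarrow>\<^sub>E carrier Y" "u \<in> carrier Y \<rightarrow>\<^sub>E carrier X"
    using assms by (auto simp: Hom_OMSupGal_iff)
  then show ?thesis
    using that[OF Pair lu] PiE_mem[OF lu(1)] PiE_arb[OF lu(1)] PiE_mem[OF lu(2)] PiE_arb[OF lu(2)]
      assms Pair by (simp add: Hom_OMSupGal_iff)
qed

section \<open>The dagger category of adjoint maps\<close>

lemma dagger_category_SupOMLatLin: "dagger_category SupOMLatLin"
proof
  fix X :: "'a ortholattice"
  assume X: "X \<in> Ob SupOMLatLin"
  show "Id SupOMLatLin X \<in> Hom SupOMLatLin X X"
    using Hom_SupOMLatLinI[OF _ is_adjoint_id] by (auto simp: SupOMLatLin_def)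
  show "Dag SupOMLatLin X X (Id SupOMLatLin X) = Id SupOMLatLin X"
    using X adjoint_eqI[OF _ is_adjoint_id] by (simp add: SupOMLatLin_def)
next
  fix X Y :: "'a ortholattice" and f
  assume XY: "X \<in> Ob SupOMLatLin" "Y \<in> Ob SupOMLatLin" and f: "f \<in> Hom SupOMLatLin X Y"
  then interpret X: complete_orthomodular_lattice X by (simp add: Ob_SupOMLatLin)
  interpret Y: complete_orthomodular_lattice Y using XY by (simp add: Ob_SupOMLatLin)
  obtain h where h: "f \<in> carrier X \<rightarrow>\<^sub>E carrier Y" "h \<in> carrier Y \<rightarrow>\<^sub>E carrier X"
    "is_adjoint X Y f h" "adjoint X Y f = h"
    using f X.complete_orthomodular_lattice_axioms by (rule Hom_SupOMLatLinE)
  have sym: "is_adjoint Y X h f"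
    using X.orthomodular_lattice_axioms Y.orthomodular_lattice_axioms h(1,3)
    by (rule is_adjoint_sym)
  show "Dag SupOMLatLin X Y f \<in> Hom SupOMLatLin Y X"
    using Hom_SupOMLatLinI[OF h(2) sym] h(4) by (simp add: SupOMLatLin_def)
  show "Dag SupOMLatLin Y X (Dag SupOMLatLin X Y f) = f"
    using adjoint_eqI[OF Y.complete_orthomodular_lattice_axioms sym] h(4)
    by (simp add: SupOMLatLin_def)
  \<comment> \<open>Equality is required on the whole type: outside \<open>carrier X\<close> both
    sides are \<open>undefined\<close>, which \<open>PiE_arb\<close> supplies for
    \<open>f\<close>.\<close>
  show "Comp SupOMLatLin X Y Y (Id SupOMLatLin Y) f = f"
    using PiE_mem[OF h(1)] PiE_arb[OF h(1)]
    by (simp add: SupOMLatLin_def compose_def fun_eq_iff)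
  show "Comp SupOMLatLin X X Y f (Id SupOMLatLin X) = f"
    using PiE_mem[OF h(1)] PiE_arb[OF h(1)]
    by (simp add: SupOMLatLin_def compose_def fun_eq_iff)
next
  fix X Y Z :: "'a ortholattice" and f g
  assume X: "X \<in> Ob SupOMLatLin" and Y: "Y \<in> Ob SupOMLatLin"
    and f: "f \<in> Hom SupOMLatLin X Y" and g: "g \<in> Hom SupOMLatLin Y Z"
  obtain h where h: "f \<in> carrier X \<rightarrow>\<^sub>E carrier Y" "is_adjoint X Y f h" "adjoint X Y f = h"
    using f X by (auto simp: Ob_SupOMLatLin elim: Hom_SupOMLatLinE)
  obtain k where k: "g \<in> carrier Y \<rightarrow>\<^sub>E carrier Z" "is_adjoint Y Z g k" "adjoint Y Z g = k"
    using g Y by (auto simp: Ob_SupOMLatLin elim: Hom_SupOMLatLinE)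
  \<comment> \<open>One adjunction settles both claims: it puts the composite into the hom-set, and
    by uniqueness it determines the dagger.\<close>
  note hk = is_adjoint_compose[OF h(1,2) k(2)]
  show "Comp SupOMLatLin X Y Z g f \<in> Hom SupOMLatLin X Z"
    using Hom_SupOMLatLinI[OF compose_PiE[OF h(1) k(1)] hk] by (simp add: SupOMLatLin_def)
  show "Dag SupOMLatLin X Z (Comp SupOMLatLin X Y Z g f) =
      Comp SupOMLatLin Z Y X (Dag SupOMLatLin X Y f) (Dag SupOMLatLin Y Z g)"
    using adjoint_eqI[OF _ hk] X h(3) k(3) by (simp add: SupOMLatLin_def)
next
  fix W X Y Z :: "'a ortholattice" and f g h
  assume "f \<in> Hom SupOMLatLin W X"
  then show "Comp SupOMLatLin W Y Z h (Comp SupOMLatLin W X Y g f) =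
      Comp SupOMLatLin W X Z (Comp SupOMLatLin X Y Z h g) f"
    by (auto simp: SupOMLatLin_def intro!: compose_assoc)
qed

section \<open>The dagger category of Galois connections\<close>

text \<open>The two connections turn the claim into inequalities in \<open>Y\<close>, between
  \<open>ocomp Y (u' z)\<close> and \<open>l x\<close> and between \<open>ocomp Y (l x)\<close> and
  \<open>u' z\<close>. These are equivalent by \<open>ocomp_le_iff\<close>; the inserted
  orthocomplement is what makes antitone connections compose.\<close>

lemma Comp_OMSupGal_in_Hom:
  assumes Y: "orthomodular_lattice Y"
    and f: "f \<in> Hom OMSupGal X Y" and g: "g \<in> Hom OMSupGal Y Z"
  shows "Comp OMSupGal X Y Z g f \<in> Hom OMSupGal X Z"
proof -
  interpret Y: orthomodular_lattice Y by (fact Y)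
  obtain l u where lu: "f = (l, u)"
      "\<And>x. x \<in> carrier X \<Longrightarrow> l x \<in> carrier Y" "\<And>y. y \<in> carrier Y \<Longrightarrow> u y \<in> carrier X"
      "\<And>x y. x \<in> carrier X \<Longrightarrow> y \<in> carrier Y \<Longrightarrow> x \<sqsubseteq>\<^bsub>X\<^esub> u y \<longleftrightarrow> y \<sqsubseteq>\<^bsub>Y\<^esub> l x"
    using f by (elim Hom_OMSupGalE) (rule that)
  obtain l' u' where lu': "g = (l', u')"
      "\<And>y. y \<in> carrier Y \<Longrightarrow> l' y \<in> carrier Z" "\<And>z. z \<in> carrier Z \<Longrightarrow> u' z \<in> carrier Y"
      "\<And>y z. y \<in> carrier Y \<Longrightarrow> z \<in> carrier Z \<Longrightarrow> y \<sqsubseteq>\<^bsub>Y\<^esub> u' z \<longleftrightarrow> z \<sqsubseteq>\<^bsub>Z\<^esub> l' y"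
    using g by (elim Hom_OMSupGalE) (rule that)
  have "x \<sqsubseteq>\<^bsub>X\<^esub> u (ocomp Y (u' z)) \<longleftrightarrow> z \<sqsubseteq>\<^bsub>Z\<^esub> l' (ocomp Y (l x))"
    if "x \<in> carrier X" "z \<in> carrier Z" for x z
    using that by (simp add: lu lu'(2,3) lu'(4)[symmetric] Y.ocomp_closed Y.ocomp_le_iff)
  then show ?thesis
    by (simp add: OMSupGal_def lu(1-3) lu'(1-3) compose_def Y.ocomp_closed)
qed

lemma dagger_category_OMSupGal: "dagger_category OMSupGal"
proof
  fix X :: "'a ortholattice"
  assume X: "X \<in> Ob OMSupGal"
  then interpret X: complete_orthomodular_lattice X by (simp add: Ob_OMSupGal)
  show "Id OMSupGal X \<in> Hom OMSupGal X X"
    by (auto simp: OMSupGal_def X.ocomp_closed X.le_ocomp_iff)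
  show "Dag OMSupGal X X (Id OMSupGal X) = Id OMSupGal X"
    by (simp add: OMSupGal_def)
next
  fix X Y :: "'a ortholattice" and f
  assume XY: "X \<in> Ob OMSupGal" "Y \<in> Ob OMSupGal" and f: "f \<in> Hom OMSupGal X Y"
  then interpret X: complete_orthomodular_lattice X by (simp add: Ob_OMSupGal)
  interpret Y: complete_orthomodular_lattice Y using XY by (simp add: Ob_OMSupGal)
  obtain l u where lu: "f = (l, u)"
      "\<And>x. x \<in> carrier X \<Longrightarrow> l x \<in> carrier Y" "\<And>x. x \<notin> carrier X \<Longrightarrow> l x = undefined"
      "\<And>y. y \<in> carrier Y \<Longrightarrow> u y \<in> carrier X" "\<And>y. y \<notin> carrier Y \<Longrightarrow> u y = undefined"
    using f by (elim Hom_OMSupGalE) (rule that)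
  show "Dag OMSupGal X Y f \<in> Hom OMSupGal Y X"
    using f by (auto simp: OMSupGal_def)
  show "Dag OMSupGal Y X (Dag OMSupGal X Y f) = f"
    by (simp add: OMSupGal_def)
  \<comment> \<open>The identity is itself an orthocomplement and cancels against the one inserted
    by composition.\<close>
  show "Comp OMSupGal X Y Y (Id OMSupGal Y) f = f"
    by (simp add: OMSupGal_def compose_def fun_eq_iff lu Y.ocomp_closed Y.ocomp_ocomp)
  show "Comp OMSupGal X X Y f (Id OMSupGal X) = f"
    by (simp add: OMSupGal_def compose_def fun_eq_iff lu X.ocomp_closed X.ocomp_ocomp)
next
  fix X Y Z :: "'a ortholattice" and f g
  assume "X \<in> Ob OMSupGal" and Y: "Y \<in> Ob OMSupGal"
    and f: "f \<in> Hom OMSupGal X Y" and g: "g \<in> Hom OMSupGal Y Z"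
  then interpret Y: complete_orthomodular_lattice Y by (simp add: Ob_OMSupGal)
  show "Comp OMSupGal X Y Z g f \<in> Hom OMSupGal X Z"
    using Y.orthomodular_lattice_axioms f g by (rule Comp_OMSupGal_in_Hom)
  \<comment> \<open>The components of a composite are mirror images, both passing through
    \<open>ocomp Y\<close>, so swapping them suffices.\<close>
  show "Dag OMSupGal X Z (Comp OMSupGal X Y Z g f) =
      Comp OMSupGal Z Y X (Dag OMSupGal X Y f) (Dag OMSupGal Y Z g)"
    by (simp add: OMSupGal_def)
next
  fix W X Y Z :: "'a ortholattice" and f g h
  assume "X \<in> Ob OMSupGal" "Y \<in> Ob OMSupGal"
    and fgh: "f \<in> Hom OMSupGal W X" "g \<in> Hom OMSupGal X Y" "h \<in> Hom OMSupGal Y Z"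
  then interpret X: complete_orthomodular_lattice X by (simp add: Ob_OMSupGal)
  interpret Y: complete_orthomodular_lattice Y using \<open>Y \<in> Ob OMSupGal\<close> by (simp add: Ob_OMSupGal)
  show "Comp OMSupGal W Y Z h (Comp OMSupGal W X Y g f) =
      Comp OMSupGal W X Z (Comp OMSupGal X Y Z h g) f"
    using fgh
    by (elim Hom_OMSupGalE)
      (simp add: OMSupGal_def compose_def fun_eq_iff X.ocomp_closed Y.ocomp_closed)
qed

section \<open>The bijection between hom-sets\<close>

text \<open>Only the inequality in \<open>Y\<close> has to be flipped; the one in \<open>X\<close>
  already has the form \<open>x \<sqsubseteq> ocomp X (h y)\<close>. One direction serves
  \<open>Lambda\<close>, the other \<open>Gamma\<close>.\<close>

lemma Hom_OMSupGal_compose_ocomp_iff: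
  assumes "orthomodular_lattice X" "orthomodular_lattice Y"
    and f: "f \<in> carrier X \<rightarrow>\<^sub>E carrier Y" and h: "h \<in> carrier Y \<rightarrow>\<^sub>E carrier X"
  shows "(compose (carrier X) (ocomp Y) f, compose (carrier Y) (ocomp X) h) \<in> Hom OMSupGal X Y \<longleftrightarrow>
    is_adjoint X Y f h"
proof -
  interpret X: orthomodular_lattice X by fact
  interpret Y: orthomodular_lattice Y by fact
  have "f x \<in> carrier Y" "ocomp Y (f x) \<in> carrier Y" if "x \<in> carrier X" for x
    using f that by (auto intro: Y.ocomp_closed)
  moreover have "h y \<in> carrier X" "ocomp X (h y) \<in> carrier X" if "y \<in> carrier Y" for y
    using h that by (auto intro: X.ocomp_closed)
  ultimately show ?thesis
    using h by (auto simp: Hom_OMSupGal_iff is_adjoint_def orthogonal_def compose_def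
        Y.le_ocomp_iff)
qed

lemma compose_ocomp_PiE:
  assumes "orthomodular_lattice Y" "f \<in> A \<rightarrow>\<^sub>E carrier Y"
  shows "compose A (ocomp Y) f \<in> A \<rightarrow>\<^sub>E carrier Y"
  using assms orthomodular_lattice.ocomp_closed[of Y] by (auto simp: compose_def)

lemma compose_ocomp_compose_ocomp:
  assumes "orthomodular_lattice Y" "f \<in> A \<rightarrow>\<^sub>E carrier Y"
  shows "compose A (ocomp Y) (compose A (ocomp Y) f) = f"
  using assms(1) PiE_mem[OF assms(2)] PiE_arb[OF assms(2)]
  by (simp add: compose_def fun_eq_iff orthomodular_lattice.ocomp_ocomp)

lemma is_adjoint_Gamma:
  assumes "orthomodular_lattice X" "orthomodular_lattice Y" and g: "(l, u) \<in> Hom OMSupGal X Y"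
  shows "is_adjoint X Y (compose (carrier X) (ocomp Y) l) (compose (carrier Y) (ocomp X) u)"
proof -
  have lu: "l \<in> carrier X \<rightarrow>\<^sub>E carrier Y" "u \<in> carrier Y \<rightarrow>\<^sub>E carrier X"
    using g by (auto simp: Hom_OMSupGal_iff)
  show ?thesis
    \<comment> \<open>The equivalence is applied to the complemented maps; complementing them again
      restores \<open>(l, u)\<close>.\<close>
    using Hom_OMSupGal_compose_ocomp_iff[OF assms(1,2) compose_ocomp_PiE compose_ocomp_PiE] lu g
    by (simp add: assms(1,2) compose_ocomp_compose_ocomp)
qed

lemma Gamma_in_Hom:
  assumes "orthomodular_lattice X" "orthomodular_lattice Y" and g: "g \<in> Hom OMSupGal X Y"
  shows "Gamma X Y g \<in> Hom SupOMLatLin X Y"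
proof -
  obtain l u where [simp]: "g = (l, u)" by (cases g)
  show ?thesis
    unfolding Gamma_def
  proof (rule Hom_SupOMLatLinI)
    show "compose (carrier X) (ocomp Y) (fst g) \<in> carrier X \<rightarrow>\<^sub>E carrier Y"
      using g assms(2) by (simp add: Hom_OMSupGal_iff compose_ocomp_PiE)
    show "is_adjoint X Y (compose (carrier X) (ocomp Y) (fst g)) (compose (carrier Y) (ocomp X) u)"
      using g assms(1,2) by (simp add: is_adjoint_Gamma)
  qed
qed

text \<open>The upper component is the delicate one: uniqueness evaluates the adjoint of
  \<open>Gamma X Y g\<close> to the complemented \<open>u\<close>, and then double complements
  cancel.\<close>

lemma Lambda_Gamma:
  assumes X: "complete_orthomodular_lattice X" and Y: "complete_orthomodular_lattice Y"
    and g: "g \<in> Hom OMSupGal X Y"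
  shows "Lambda X Y (Gamma X Y g) = g"
proof -
  obtain l u where [simp]: "g = (l, u)" by (cases g)
  note XY = X[THEN complete_orthomodular_lattice.axioms(1)]
    Y[THEN complete_orthomodular_lattice.axioms(1)]
  have "adjoint X Y (compose (carrier X) (ocomp Y) l) = compose (carrier Y) (ocomp X) u"
    using adjoint_eqI[OF X is_adjoint_Gamma[OF XY]] g by simp
  then show ?thesis
    using g XY by (simp add: Lambda_def Gamma_def Hom_OMSupGal_iff compose_ocomp_compose_ocomp)
qed

lemma Gamma_Lambda:
  assumes "orthomodular_lattice Y" "f \<in> Hom SupOMLatLin X Y"
  shows "Gamma X Y (Lambda X Y f) = f"
  using assms by (simp add: SupOMLatLin_def Gamma_def Lambda_def compose_ocomp_compose_ocomp)

text \<open>Swapping the components of \<open>Lambda X Y f\<close> leaves only the second one to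
  compare, and there the adjoint of the adjoint is \<open>f\<close>.\<close>

lemma Lambda_adjoint:
  assumes "X \<in> Ob SupOMLatLin" "Y \<in> Ob SupOMLatLin" "f \<in> Hom SupOMLatLin X Y"
  shows "Lambda Y X (Dag SupOMLatLin X Y f) = Dag OMSupGal X Y (Lambda X Y f)"
  using dagger_category.Dag_Dag[OF dagger_category_SupOMLatLin assms]
  by (simp add: Lambda_def SupOMLatLin_def OMSupGal_def)

section \<open>Functoriality\<close>

text \<open>\<open>Gamma\<close> reads only lower components, so no adjoint of a composite has to be
  computed. The orthocomplement inserted by composition is exactly the one that \<open>Gamma\<close>
  adds to the first arrow.\<close>

lemma category_functor_Gamma: "category_functor OMSupGal SupOMLatLin id Gamma"
proof -
  interpret S: dagger_category SupOMLatLin by (rule dagger_category_SupOMLatLin)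
  interpret G: dagger_category OMSupGal by (rule dagger_category_OMSupGal)
  show ?thesis
  proof
    fix X :: "'a ortholattice"
    assume X: "X \<in> Ob OMSupGal"
    then interpret X: complete_orthomodular_lattice X by (simp add: Ob_OMSupGal)
    show "id X \<in> Ob SupOMLatLin"
      using X by (simp add: Ob_SupOMLatLin Ob_OMSupGal)
    show "Gamma X X (Id OMSupGal X) = Id SupOMLatLin (id X)"
      by (auto simp: Gamma_def SupOMLatLin_def OMSupGal_def compose_def fun_eq_iff X.ocomp_ocomp)
  next
    fix X Y :: "'a ortholattice" and f
    assume "X \<in> Ob OMSupGal" "Y \<in> Ob OMSupGal" "f \<in> Hom OMSupGal X Y"
    then show "Gamma X Y f \<in> Hom SupOMLatLin (id X) (id Y)"
      by (simp add: Ob_OMSupGal complete_orthomodular_lattice.axioms(1) Gamma_in_Hom)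
  next
    fix X Y Z :: "'a ortholattice" and f g
    assume "Y \<in> Ob OMSupGal" and f: "f \<in> Hom OMSupGal X Y"
    then interpret Y: complete_orthomodular_lattice Y by (simp add: Ob_OMSupGal)
    show "Gamma X Z (Comp OMSupGal X Y Z g f) =
        Comp SupOMLatLin (id X) (id Y) (id Z) (Gamma Y Z g) (Gamma X Y f)"
      using f by (elim Hom_OMSupGalE)
        (simp add: Gamma_def SupOMLatLin_def OMSupGal_def compose_def fun_eq_iff Y.ocomp_closed)
  qed
qed

lemma Lambda_in_Hom:
  assumes X: "complete_orthomodular_lattice X" and Y: "complete_orthomodular_lattice Y"
    and f: "f \<in> Hom SupOMLatLin X Y"
  shows "Lambda X Y f \<in> Hom OMSupGal X Y"
  using f X
proof (rule Hom_SupOMLatLinE)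
  fix h
  assume "f \<in> carrier X \<rightarrow>\<^sub>E carrier Y" "h \<in> carrier Y \<rightarrow>\<^sub>E carrier X"
    "is_adjoint X Y f h" "adjoint X Y f = h"
  then show ?thesis
    using X Y by (simp add: Lambda_def Hom_OMSupGal_compose_ocomp_iff
        complete_orthomodular_lattice.axioms(1))
qed

text \<open>Being inverse to the functor \<open>\<Gamma>\<close> on morphisms, \<open>\<Lambda>\<close> is itself functorial.\<close>

lemma category_functor_Lambda: "category_functor SupOMLatLin OMSupGal id Lambda"
proof -
  interpret S: dagger_category SupOMLatLin by (rule dagger_category_SupOMLatLin)
  interpret G: dagger_category OMSupGal by (rule dagger_category_OMSupGal)
  interpret Gamma: category_functor OMSupGal SupOMLatLin id Gamma by (rule category_functor_Gamma)
  show ?thesis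
  proof
    fix X :: "'a ortholattice"
    assume "X \<in> Ob SupOMLatLin"
    then have X: "complete_orthomodular_lattice X" by (simp add: Ob_SupOMLatLin)
    then show "id X \<in> Ob OMSupGal" by (simp add: Ob_OMSupGal)
    show "Lambda X X (Id SupOMLatLin X) = Id OMSupGal (id X)"
      using Lambda_Gamma[OF X X G.Id_in_Hom] Gamma.FM_Id[of X] X by (simp add: Ob_OMSupGal)
  next
    fix X Y :: "'a ortholattice" and f
    assume "X \<in> Ob SupOMLatLin" "Y \<in> Ob SupOMLatLin" "f \<in> Hom SupOMLatLin X Y"
    then show "Lambda X Y f \<in> Hom OMSupGal (id X) (id Y)"
      by (simp add: Ob_SupOMLatLin Lambda_in_Hom)
  next
    fix X Y Z :: "'a ortholattice" and f g
    assume "X \<in> Ob SupOMLatLin" "Y \<in> Ob SupOMLatLin" "Z \<in> Ob SupOMLatLin"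
      and f: "f \<in> Hom SupOMLatLin X Y" and g: "g \<in> Hom SupOMLatLin Y Z"
    then have X: "complete_orthomodular_lattice X" and Y: "complete_orthomodular_lattice Y"
      and Z: "complete_orthomodular_lattice Z"
      by (simp_all add: Ob_SupOMLatLin)
    \<comment> \<open>\<open>Gamma\<close> sends \<open>?c\<close> to the composite of
      \<open>f\<close> and \<open>g\<close>, so \<open>Lambda\<close> sends that composite back to
      \<open>?c\<close>; this last step needs \<open>?c\<close> to be an arrow.\<close>
    let ?c = "Comp OMSupGal X Y Z (Lambda Y Z g) (Lambda X Y f)"
    have Lf: "Lambda X Y f \<in> Hom OMSupGal X Y" and Lg: "Lambda Y Z g \<in> Hom OMSupGal Y Z"
      using Lambda_in_Hom X Y Z f g by auto
    then have "?c \<in> Hom OMSupGal X Z"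
      using G.Comp_in_Hom X Y Z by (simp add: Ob_OMSupGal)
    moreover have "Gamma X Z ?c = Comp SupOMLatLin X Y Z g f"
      using Gamma.FM_Comp[OF _ _ _ Lf Lg] X Y Z f g
      by (simp add: Ob_OMSupGal Gamma_Lambda complete_orthomodular_lattice.axioms(1))
    ultimately show "Lambda X Z (Comp SupOMLatLin X Y Z g f) =
        Comp OMSupGal (id X) (id Y) (id Z) (Lambda Y Z g) (Lambda X Y f)"
      using Lambda_Gamma[OF X Z] by fastforce
  qed
qed

section \<open>The dagger isomorphism\<close>

theorem theorem3:
  fixes S :: "('a ortholattice, 'a \<Rightarrow> 'a) dagger_category"
    and G :: "('a ortholattice, ('a \<Rightarrow> 'a) \<times> ('a \<Rightarrow> 'a)) dagger_category"
  assumes "S = SupOMLatLin" and "G = OMSupGal"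
  shows "dagger_category S \<and> dagger_category G \<and>
    category_functor S G id Lambda \<and>
    category_functor G S id Gamma \<and>
    full S G id Lambda \<and>
    faithful S Lambda \<and>
    essentially_surjective S G id \<and>
    (\<forall>X \<in> Ob G. \<forall>Y \<in> Ob G. \<forall>g \<in> Hom G X Y. Lambda X Y (Gamma X Y g) = g) \<and>
    (\<forall>X \<in> Ob S. \<forall>Y \<in> Ob S. \<forall>f \<in> Hom S X Y.
      Lambda Y X (Dag S X Y f) = Dag G X Y (Lambda X Y f)) \<and>
    dagger_isomorphic S G"
proof -
  interpret G: dagger_category G
    unfolding assms by (rule dagger_category_OMSupGal)
  have S_dag: "dagger_category S" and G_dag: "dagger_category G"
    and Lambda: "category_functor S G id Lambda" and Gamma: "category_functor G S id Gamma"
    unfolding assms by (fact dagger_category_SupOMLatLin dagger_category_OMSupGal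
        category_functor_Lambda category_functor_Gamma)+
  have Ob: "Ob S = Ob G"
    by (simp add: assms SupOMLatLin_def OMSupGal_def)
  have LG: "Lambda X Y (Gamma X Y g) = g" if "X \<in> Ob G" "Y \<in> Ob G" "g \<in> Hom G X Y" for X Y g
    using that by (simp add: assms Ob_OMSupGal Lambda_Gamma)
  \<comment> \<open>The preimage of \<open>g\<close> is \<open>Gamma X Y g\<close>.\<close>
  have full: "full S G id Lambda"
    unfolding full_def Ob using LG category_functor.FM_in_Hom[OF Gamma]
    by (metis id_apply)
  \<comment> \<open>Here \<open>Gamma\<close> acts as a left inverse.\<close>
  have faithful: "faithful S Lambda"
    unfolding faithful_def assms
    by (metis Gamma_Lambda Ob_SupOMLatLin complete_orthomodular_lattice.axioms(1) inj_on_inverseI)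
  \<comment> \<open>Each object is its own preimage, with its identity arrow as the isomorphism in
    both directions.\<close>
  have ess: "essentially_surjective S G id"
    unfolding essentially_surjective_def isomorphic_objects_def Ob
    using G.Id_in_Hom G.Comp_Id_left by (metis id_apply)
  have dag: "\<forall>X \<in> Ob S. \<forall>Y \<in> Ob S. \<forall>f \<in> Hom S X Y.
      Lambda Y X (Dag S X Y f) = Dag G X Y (Lambda X Y f)"
    using Lambda_adjoint by (auto simp: assms)
  then have "dagger_isomorphic S G"
    unfolding dagger_isomorphic_def preserves_dagger_def
    using S_dag G_dag Lambda full faithful ess by (metis id_apply)
  then show ?thesis
    using S_dag G_dag Lambda Gamma full faithful ess LG dag by blast
qed

end
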